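(* Let $R$ be a unique factorization domain, $p\in R$ a prime element, $g,h$ nonconstant algebraically primitive Dirichlet polynomials with coefficients in $R$, and $f=g\cdot h$. Then the Newton log-polygon of $f$ with respect to $p$ is obtained from translates of the edges of the Newton log-polygons of $g$ and $h$ with respect to $p$, using exactly one translate of each edge, arranged into a polygonal line with increasing slopes from left to right. Equivalently: the set of slopes of edges of the Newton log-polygon of $f$ is the union of the sets of slopes of edges of the Newton log-polygons of $g$ and $h$, and for each such slope $S$, the vector of the edge of slope $S$ of the Newton log-polygon of $f$ equals the sum of the vectors of the edges of slope $S$ of the Newton log-polygons of $g$ and $h$ (an absent edge contributing zero).
   Context: Dirichlet polynomials $\sum_i \frac{A_i}{i^s}$ are multiplied by the Dirichlet product $\left(\sum_j\frac{b_j}{j^s}\right)\left(\sum_k\frac{c_k}{k^s}\right)=\sum_i\frac{\sum_{jk=i}b_jc_k}{i^s}$; constant means supported on $\{1\}$; algebraically primitive means the indices $i$ with $A_i\neq0$ have gcd $1$. For $f=\frac{A_m}{m^s}+\cdots+\frac{A_n}{n^s}$ with $A_mA_n\neq0$, $m<n$, and $\nu_p$ the $p$-adic valuation, the Newton log-polygon of $f$ with respect to $p$ is the lower convex hull of the points $(\log i,\nu_p(A_i))$ for $A_i\neq 0$, i.e. the polygonal line $P_1P_2\cdots P_r$ from $P_1=(\log m,\nu_p(A_m))$ to $P_r=(\log n,\nu_p(A_n))$ where each $P_{j+1}=(\log i,\nu_p(A_i))$ is chosen with $i$ the largest index such that no point $(\log i',\nu_p(A_{i'}))$ lies strictly below the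 line $P_jP_{j+1}$. The segments $P_jP_{j+1}$ are its edges, and $\overrightarrow{P_jP_{j+1}}$ their vectors. *)

theory Defs
  imports "HOL-Analysis.Analysis" "HOL-Computational_Algebra.Factorial_Ring"
begin

text \<open>
  The Dirichlet polynomial with coefficients \<open>A i\<close> is represented by the coefficient function
  \<open>A\<close>; indices are positive, so the coefficient at 0 has to vanish.
\<close>

definition dirichlet_poly :: "(nat \<Rightarrow> 'a::zero) \<Rightarrow> bool" where
  "dirichlet_poly f \<longleftrightarrow> f 0 = 0 \<and> finite {i. f i \<noteq> 0}"

definition dirichlet_mult ::
    "(nat \<Rightarrow> 'a::comm_semiring_0) \<Rightarrow> (nat \<Rightarrow> 'a) \<Rightarrow> nat \<Rightarrow> 'a" where
  "dirichlet_mult g h i = (if i = 0 then 0 else (\<Sum>(j, k)\<in>{(j, k). j * k = i}. g j * h k))"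

definition dirichlet_constant :: "(nat \<Rightarrow> 'a::zero) \<Rightarrow> bool" where
  "dirichlet_constant f \<longleftrightarrow> {i. f i \<noteq> 0} \<subseteq> {1}"

definition algebraically_primitive :: "(nat \<Rightarrow> 'a::zero) \<Rightarrow> bool" where
  "algebraically_primitive f \<longleftrightarrow> Gcd {i. f i \<noteq> 0} = 1"

definition newton_point :: "'a::factorial_semiring \<Rightarrow> (nat \<Rightarrow> 'a) \<Rightarrow> nat \<Rightarrow> real \<times> real" where
  "newton_point p f i = (ln (real i), real (multiplicity p (f i)))"

definition strictly_below_line :: "real \<times> real \<Rightarrow> real \<times> real \<Rightarrow> real \<times> real \<Rightarrow> bool" where
  "strictly_below_line X A B \<longleftrightarrow>
     snd X < snd A + (snd B - snd A) / (fst B - fst A) * (fst X - fst A)"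

text \<open>
  The indices \<open>i > a\<close> such that no point of \<open>f\<close> lies strictly below the line
  through the points with indices \<open>a\<close> and \<open>i\<close>.
\<close>

definition newton_candidates :: "'a::factorial_semiring \<Rightarrow> (nat \<Rightarrow> 'a) \<Rightarrow> nat \<Rightarrow> nat set" where
  "newton_candidates p f a = {i. a < i \<and> f i \<noteq> 0 \<and>
     \<not> (\<exists>i'. f i' \<noteq> 0 \<and>
          strictly_below_line (newton_point p f i') (newton_point p f a) (newton_point p f i))}"

text \<open>
  For a vertex \<open>a\<close> the candidate set is empty only if \<open>a\<close> is the largest index of the support.
  The condition \<^term>\<open>dirichlet_poly f\<close> in the recursion only serves termination.
\<close>

function newton_indices_from :: "'a::factorial_semiring \<Rightarrow> (nat \<Rightarrow> 'a) \<Rightarrow> nat \<Rightarrow> nat list" where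
  "newton_indices_from p f a =
     (if dirichlet_poly f \<and> newton_candidates p f a \<noteq> {}
      then a # newton_indices_from p f (Max (newton_candidates p f a))
      else [a])"
  by auto
termination
proof (relation "Wellfounded.measure (\<lambda>(p, f, a). card {i. a < i \<and> f i \<noteq> 0})", goal_cases)
  case 1
  then show ?case by simp
next
  case (2 p f a)
  define C where "C = newton_candidates p f a"
  have fin: "finite {i. f i \<noteq> 0}"
    using 2 by (simp add: dirichlet_poly_def)
  have sub: "C \<subseteq> {i. a < i \<and> f i \<noteq> 0}"
    by (auto simp: C_def newton_candidates_def)
  have finS: "finite {i. a < i \<and> f i \<noteq> 0}"
    using fin by (rule rev_finite_subset) auto
  have "Max C \<in> C"
    using 2 sub finS by (intro Max_in) (auto simp: C_def intro: finite_subset)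
  with sub have "Max C \<in> {i. a < i \<and> f i \<noteq> 0}"
    by blast
  then have "{i. Max C < i \<and> f i \<noteq> 0} \<subset> {i. a < i \<and> f i \<noteq> 0}"
    by auto
  with finS show ?case
    by (simp add: C_def psubset_card_mono)
qed

declare newton_indices_from.simps [simp del]

definition newton_vertices :: "'a::factorial_semiring \<Rightarrow> (nat \<Rightarrow> 'a) \<Rightarrow> (real \<times> real) list" where
  "newton_vertices p f =
     map (newton_point p f) (newton_indices_from p f (Min {i. f i \<noteq> 0}))"

type_synonym edge = "(real \<times> real) \<times> (real \<times> real)"

definition edges :: "(real \<times> real) list \<Rightarrow> edge list" where
  "edges Ps = zip Ps (tl Ps)"

definition edge_vector :: "edge \<Rightarrow> real \<times> real" where
  "edge_vector e = snd e - fst e"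

definition edge_slope :: "edge \<Rightarrow> real" where
  "edge_slope e = snd (edge_vector e) / fst (edge_vector e)"

definition polygonal_line :: "(real \<times> real) list \<Rightarrow> (real \<times> real) set" where
  "polygonal_line Ps = set Ps \<union> (\<Union>(P, Q)\<in>set (edges Ps). closed_segment P Q)"

definition newton_log_polygon :: "'a::factorial_semiring \<Rightarrow> (nat \<Rightarrow> 'a) \<Rightarrow> (real \<times> real) set" where
  "newton_log_polygon p f = polygonal_line (newton_vertices p f)"

definition newton_edges :: "'a::factorial_semiring \<Rightarrow> (nat \<Rightarrow> 'a) \<Rightarrow> edge list" where
  "newton_edges p f = edges (newton_vertices p f)"

definition newton_slopes :: "'a::factorial_semiring \<Rightarrow> (nat \<Rightarrow> 'a) \<Rightarrow> real set" where
  "newton_slopes p f = edge_slope ` set (newton_edges p f)"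

text \<open>
  The edges of a Newton log-polygon have pairwise distinct slopes, so the edge of a given slope
  is unique if it exists; an absent edge contributes the zero vector.
\<close>

definition newton_vector ::
    "'a::factorial_semiring \<Rightarrow> (nat \<Rightarrow> 'a) \<Rightarrow> real \<Rightarrow> real \<times> real" where
  "newton_vector p f S =
     (if S \<in> newton_slopes p f
      then edge_vector (THE e. e \<in> set (newton_edges p f) \<and> edge_slope e = S)
      else 0)"

end

theory Submission
  imports Defs
begin

text \<open>
  For a slope \<open>s\<close>, consider the indices \<open>i\<close> of the support minimising
  \<open>\<nu>\<^sub>p(A\<^sub>i) - s log i\<close>. The Newton log-polygon has an edge of slope \<open>s\<close> exactly if there are at
  least two of them, and this edge then joins the points of the smallest and of the largest one.
  As in Gauss' lemma, the smallest and the largest minimising indices are multiplicative in the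
  Dirichlet polynomial, so the horizontal length of the (possibly trivial) edge of slope \<open>s\<close> is
  additive.
\<close>

text \<open>The vertex recursion is greedy and does not interact well with products, whereas
  supporting lines do: since \<open>ln (j * k) = ln j + ln k\<close>, the minimised quantity is
  additive over pairs of indices, for each fixed slope. Multiplicativity of the extremes comes from
  the order of the positive integers. If \<open>a\<close> and \<open>b\<close> are the smallest
  minimising indices, no other pair of minimising indices has product \<open>a * b\<close>. Every
  other pair with this product therefore has a larger sum of valuations, and the term of
  \<open>a\<close> and \<open>b\<close> cannot be cancelled. The same holds for the largest ones.
  Between the extremes several pairs may share a product and cancel, so only the ends of an edge are
  tracked. A slope shared by both factors gives two collinear translates but only one edge of the
  product. The rearranged line and the polygon of the product are therefore compared as sets of
  points, not as lists of vertices.\<close>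

definition newton_height :: "'a::factorial_semiring \<Rightarrow> (nat \<Rightarrow> 'a) \<Rightarrow> real \<Rightarrow> nat \<Rightarrow> real" where
  "newton_height p f s i = real (multiplicity p (f i)) - s * ln (real i)"

text \<open>The height is the ordinate at abscissa zero of the line of slope \<open>s\<close>
  through the point of index \<open>i\<close>. Its minimisers are thus the points on the supporting
  line of slope \<open>s\<close> from below.\<close>

definition newton_face :: "'a::factorial_semiring \<Rightarrow> (nat \<Rightarrow> 'a) \<Rightarrow> real \<Rightarrow> nat set" where
  "newton_face p f s =
     {i. f i \<noteq> 0 \<and> (\<forall>j. f j \<noteq> 0 \<longrightarrow> newton_height p f s i \<le> newton_height p f s j)}"

definition newton_width :: "'a::factorial_semiring \<Rightarrow> (nat \<Rightarrow> 'a) \<Rightarrow> real \<Rightarrow> real" where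
  "newton_width p f s =
     ln (real (Max (newton_face p f s))) - ln (real (Min (newton_face p f s)))"

definition newton_face_edge :: "'a::factorial_semiring \<Rightarrow> (nat \<Rightarrow> 'a) \<Rightarrow> real \<Rightarrow> edge" where
  "newton_face_edge p f s =
     (newton_point p f (Min (newton_face p f s)), newton_point p f (Max (newton_face p f s)))"

definition break_slopes :: "'a::factorial_semiring \<Rightarrow> (nat \<Rightarrow> 'a) \<Rightarrow> real set" where
  "break_slopes p f = {s. Min (newton_face p f s) < Max (newton_face p f s)}"

section \<open>Faces, their extreme indices and their widths\<close>

lemma dirichlet_poly_index_pos: "dirichlet_poly f \<Longrightarrow> f i \<noteq> 0 \<Longrightarrow> 0 < i"
  by (cases i) (auto simp: dirichlet_poly_def)

lemma newton_face_subset: "newton_face p f s \<subseteq> {i. f i \<noteq> 0}"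
  by (auto simp: newton_face_def)

lemma finite_newton_face: "dirichlet_poly f \<Longrightarrow> finite (newton_face p f s)"
  by (rule finite_subset[OF newton_face_subset]) (simp add: dirichlet_poly_def)

lemma newton_face_nonempty:
  assumes "dirichlet_poly f" and "\<exists>i. f i \<noteq> 0"
  shows "newton_face p f s \<noteq> {}"
proof -
  have "finite {i. f i \<noteq> 0}" "{i. f i \<noteq> 0} \<noteq> {}"
    using assms by (auto simp: dirichlet_poly_def)
  then obtain i where "is_arg_min (newton_height p f s) (\<lambda>i. i \<in> {i. f i \<noteq> 0}) i"
    using ex_is_arg_min_if_finite by blast
  then show ?thesis
    by (auto simp: is_arg_min_linorder newton_face_def)
qed

lemma Min_newton_face_in:
  "dirichlet_poly f \<Longrightarrow> \<exists>i. f i \<noteq> 0 \<Longrightarrow> Min (newton_face p f s) \<in> newton_face p f s"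
  by (simp add: finite_newton_face newton_face_nonempty)

lemma Max_newton_face_in:
  "dirichlet_poly f \<Longrightarrow> \<exists>i. f i \<noteq> 0 \<Longrightarrow> Max (newton_face p f s) \<in> newton_face p f s"
  by (simp add: finite_newton_face newton_face_nonempty)

lemma Min_newton_face_le_Max:
  "dirichlet_poly f \<Longrightarrow> \<exists>i. f i \<noteq> 0 \<Longrightarrow> Min (newton_face p f s) \<le> Max (newton_face p f s)"
  by (simp add: finite_newton_face newton_face_nonempty)

lemma newton_height_eq:
  "i \<in> newton_face p f s \<Longrightarrow> j \<in> newton_face p f s \<Longrightarrow> newton_height p f s i = newton_height p f s j"
  by (simp add: newton_face_def order_antisym)

lemma Min_newton_face_pos:
  "dirichlet_poly f \<Longrightarrow> \<exists>i. f i \<noteq> 0 \<Longrightarrow> 0 < Min (newton_face p f s)"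
  by (rule dirichlet_poly_index_pos) (use Min_newton_face_in newton_face_subset in blast)+

lemma Max_newton_face_pos:
  "dirichlet_poly f \<Longrightarrow> \<exists>i. f i \<noteq> 0 \<Longrightarrow> 0 < Max (newton_face p f s)"
  by (rule dirichlet_poly_index_pos) (use Max_newton_face_in newton_face_subset in blast)+

lemma newton_width_nonneg:
  assumes "dirichlet_poly f" and "\<exists>i. f i \<noteq> 0"
  shows "0 \<le> newton_width p f s"
  using Min_newton_face_le_Max[OF assms] Min_newton_face_pos[OF assms]
    Max_newton_face_pos[OF assms] by (simp add: newton_width_def)

lemma break_slopes_iff:
  assumes "dirichlet_poly f" and "\<exists>i. f i \<noteq> 0"
  shows "s \<in> break_slopes p f \<longleftrightarrow> 0 < newton_width p f s"
  using Min_newton_face_pos[OF assms] Max_newton_face_pos[OF assms]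
  by (simp add: newton_width_def break_slopes_def)

text \<open>Both ends have equal height, so the rise is \<open>s\<close> times the run. Width zero
  is allowed, which lets absent edges follow the same formula.\<close>

lemma edge_vector_newton_face_edge:
  assumes "dirichlet_poly f" and "\<exists>i. f i \<noteq> 0"
  shows "edge_vector (newton_face_edge p f s) = newton_width p f s *\<^sub>R (1, s)"
  using newton_height_eq[OF Min_newton_face_in[OF assms] Max_newton_face_in[OF assms], of p s]
  by (simp add: edge_vector_def newton_face_edge_def newton_point_def newton_width_def
      newton_height_def algebra_simps)

lemma edge_slope_newton_face_edge:
  assumes "dirichlet_poly f" and "\<exists>i. f i \<noteq> 0" and "s \<in> break_slopes p f"
  shows "edge_slope (newton_face_edge p f s) = s"
  using assms by (simp add: edge_slope_def edge_vector_newton_face_edge break_slopes_iff)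

text \<open>A break slope is the slope between two points of the support, and there are finitely
  many such pairs.\<close>

lemma finite_break_slopes:
  assumes "dirichlet_poly f" and "\<exists>i. f i \<noteq> 0"
  shows "finite (break_slopes p f)"
proof (rule finite_subset)
  let ?S = "{i. f i \<noteq> 0}"
  let ?edge = "\<lambda>(i, j). (newton_point p f i, newton_point p f j)"
  show "break_slopes p f \<subseteq> (\<lambda>e. edge_slope (?edge e)) ` (?S \<times> ?S)"
  proof
    fix s assume s: "s \<in> break_slopes p f"
    have "s = edge_slope (?edge (Min (newton_face p f s), Max (newton_face p f s)))"
      using edge_slope_newton_face_edge[OF assms s] by (simp add: newton_face_edge_def)
    then show "s \<in> (\<lambda>e. edge_slope (?edge e)) ` (?S \<times> ?S)"
      using Min_newton_face_in[OF assms] Max_newton_face_in[OF assms] newton_face_subset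
      by blast
  qed
  show "finite ((\<lambda>e. edge_slope (?edge e)) ` (?S \<times> ?S))"
    using assms by (simp add: dirichlet_poly_def)
qed

section \<open>Tilting the supporting line\<close>

lemma newton_height_diff:
  "newton_height p f s i - newton_height p f t i = (t - s) * ln (real i)"
  by (simp add: newton_height_def algebra_simps)

text \<open>Raising the slope from \<open>t\<close> to \<open>s\<close> lowers the height at
  \<open>i\<close> by \<open>(s - t) * ln i\<close>, hence by less to the left of \<open>a\<close>
  than at \<open>a\<close>. Consequently faces move to the right as the slope grows.\<close>

lemma newton_height_less_left:
  assumes "dirichlet_poly f" and "a \<in> newton_face p f t" and "f i \<noteq> 0" and "i < a" and "t < s"
  shows "newton_height p f s a < newton_height p f s i"
proof -
  have "0 < i"
    using assms(1,3) by (rule dirichlet_poly_index_pos)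
  then have "(s - t) * ln (real i) < (s - t) * ln (real a)"
    using assms by simp
  moreover have "newton_height p f t a \<le> newton_height p f t i"
    using assms by (simp add: newton_face_def)
  ultimately show ?thesis
    using newton_height_diff[of p f s i t] newton_height_diff[of p f s a t]
    by (simp add: algebra_simps)
qed

lemma newton_height_less_right:
  assumes "dirichlet_poly f" and "a \<in> newton_face p f t" and "f i \<noteq> 0" and "a < i" and "s < t"
  shows "newton_height p f s a < newton_height p f s i"
proof -
  have "0 < a"
    using assms(1,2) by (auto simp: newton_face_def intro: dirichlet_poly_index_pos)
  then have "(t - s) * ln (real a) < (t - s) * ln (real i)"
    using assms by simp
  moreover have "newton_height p f t a \<le> newton_height p f t i"
    using assms by (simp add: newton_face_def)
  ultimately show ?thesis
    using newton_height_diff[of p f s i t] newton_height_diff[of p f s a t]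
    by (simp add: algebra_simps)
qed

section \<open>The vertex recursion in terms of faces\<close>

lemma strictly_below_line_iff_newton_height:
  assumes "s = (snd (newton_point p f b) - snd (newton_point p f a)) /
      (fst (newton_point p f b) - fst (newton_point p f a))"
  shows "strictly_below_line (newton_point p f i) (newton_point p f a) (newton_point p f b) \<longleftrightarrow>
    newton_height p f s i < newton_height p f s a"
  unfolding strictly_below_line_def assms[symmetric]
  by (simp add: newton_point_def newton_height_def algebra_simps)

lemma newton_height_eq_iff_slope:
  assumes "0 < a" and "a < b"
  shows "newton_height p f s a = newton_height p f s b \<longleftrightarrow>
    s = (snd (newton_point p f b) - snd (newton_point p f a)) /
      (fst (newton_point p f b) - fst (newton_point p f a))"
  using assms by (auto simp: newton_point_def newton_height_def field_simps)

text \<open>No point lies below the line through \<open>a\<close> and \<open>b\<close> exactly if it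
  is a supporting line, and then its slope is the one whose face contains both.\<close>

lemma newton_candidates_iff:
  assumes "dirichlet_poly f" and "f a \<noteq> 0"
  shows "b \<in> newton_candidates p f a \<longleftrightarrow>
    a < b \<and> (\<exists>s. a \<in> newton_face p f s \<and> b \<in> newton_face p f s)"
proof (cases "a < b")
  case True
  define s where "s = (snd (newton_point p f b) - snd (newton_point p f a)) /
      (fst (newton_point p f b) - fst (newton_point p f a))"
  have pos: "0 < a"
    using assms by (rule dirichlet_poly_index_pos)
  have eq: "newton_height p f t a = newton_height p f t b \<longleftrightarrow> t = s" for t
    unfolding s_def by (rule newton_height_eq_iff_slope[OF pos True])
  have "b \<in> newton_candidates p f a \<longleftrightarrow>
      f b \<noteq> 0 \<and> (\<forall>i. f i \<noteq> 0 \<longrightarrow> newton_height p f s a \<le> newton_height p f s i)"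
    using True by (auto simp: newton_candidates_def not_less
        strictly_below_line_iff_newton_height[OF s_def])
  also have "\<dots> \<longleftrightarrow> a \<in> newton_face p f s \<and> b \<in> newton_face p f s"
    using eq[of s] assms by (auto simp: newton_face_def)
  \<comment> \<open>Equal heights at two different indices force the slope, so a common face can
    only be that of \<open>s\<close>.\<close>
  also have "\<dots> \<longleftrightarrow> (\<exists>t. a \<in> newton_face p f t \<and> b \<in> newton_face p f t)"
    using eq newton_height_eq by metis
  finally show ?thesis
    using True by blast
qed (auto simp: newton_candidates_def)

lemma finite_newton_candidates: "dirichlet_poly f \<Longrightarrow> finite (newton_candidates p f a)"
  by (rule finite_subset[of _ "{i. f i \<noteq> 0}"]) (auto simp: newton_candidates_def dirichlet_poly_def)

text \<open>One step of gift wrapping: among the lines from \<open>a\<close> to later points, one of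
  least slope is a supporting line. That \<open>a\<close> is the right end of a face keeps the
  points to its left above this line.\<close>

lemma newton_candidates_nonempty:
  assumes f: "dirichlet_poly f" and a: "a = Max (newton_face p f t)" "a \<in> newton_face p f t"
    and i: "f i \<noteq> 0" "a < i"
  shows "newton_candidates p f a \<noteq> {}"
proof -
  define T where "T = {i. f i \<noteq> 0 \<and> a < i}"
  define \<sigma> where "\<sigma> j = (snd (newton_point p f j) - snd (newton_point p f a)) /
      (fst (newton_point p f j) - fst (newton_point p f a))" for j
  have "finite T" "T \<noteq> {}"
    using f i by (auto simp: T_def dirichlet_poly_def intro: rev_finite_subset)
  then obtain b where b: "b \<in> T" and min: "\<And>j. j \<in> T \<Longrightarrow> \<sigma> b \<le> \<sigma> j"
    using ex_is_arg_min_if_finite[of T \<sigma>] by (auto simp: is_arg_min_linorder)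
  have pos: "0 < a"
    using f a(2) by (auto simp: newton_face_def intro: dirichlet_poly_index_pos)
  have fa: "f a \<noteq> 0"
    using a(2) by (simp add: newton_face_def)
  have eq: "newton_height p f (\<sigma> j) a = newton_height p f (\<sigma> j) j" if "j \<in> T" for j
    using that pos newton_height_eq_iff_slope[of a j p f] by (simp add: T_def \<sigma>_def)
  \<comment> \<open>Equality would put \<open>b\<close> into the face of \<open>t\<close>, beyond
    its maximum; a smaller slope would make \<open>a\<close> strictly lower than \<open>b\<close>,
    although both have equal height at slope \<open>\<sigma> b\<close>.\<close>
  have "t < \<sigma> b"
  proof (rule ccontr)
    assume "\<not> t < \<sigma> b"
    then consider "\<sigma> b = t" | "\<sigma> b < t" by linarith
    then show False
    proof cases
      case 1
      then have "b \<in> newton_face p f t"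
        using eq[OF b] a(2) b by (auto simp: newton_face_def T_def)
      then have "b \<le> a"
        using a(1) finite_newton_face[OF f] by simp
      then show False
        using b by (simp add: T_def)
    next
      case 2
      then show False
        using newton_height_less_right[OF f a(2), of b "\<sigma> b"] b eq[OF b] by (simp add: T_def)
    qed
  qed
  have le: "newton_height p f (\<sigma> b) a \<le> newton_height p f (\<sigma> b) j" if "f j \<noteq> 0" for j
  proof -
    consider "j < a" | "j = a" | "a < j" by linarith
    then show ?thesis
    proof cases
      case 1
      then show ?thesis
        using newton_height_less_left[OF f a(2) that _ \<open>t < \<sigma> b\<close>] by simp
    next
      case 3
      with that have j: "j \<in> T"
        by (simp add: T_def)
      \<comment> \<open>This product is the height of \<open>j\<close> minus the height of
        \<open>a\<close> at slope \<open>\<sigma> b\<close>.\<close>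
      have "0 \<le> (\<sigma> j - \<sigma> b) * (ln (real j) - ln (real a))"
        using min[OF j] 3 pos by simp
      then show ?thesis
        using eq[OF j] by (simp add: newton_height_def algebra_simps)
    qed simp
  qed
  then have "a \<in> newton_face p f (\<sigma> b)" "b \<in> newton_face p f (\<sigma> b)"
    using fa b eq[OF b] by (auto simp: newton_face_def T_def)
  then have "b \<in> newton_candidates p f a"
    using newton_candidates_iff[OF f fa] b by (auto simp: T_def)
  then show ?thesis by blast
qed

lemma sorted_list_of_set_Cons:
  fixes A :: "'a::linorder set"
  assumes "finite A" and "x \<in> A" and "\<And>y. y \<in> A \<Longrightarrow> x \<le> y"
  shows "sorted_list_of_set A = x # sorted_list_of_set {y \<in> A. x < y}"
proof -
  have "Min A = x"
    using assms by (intro Min_eqI)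
  moreover have "A - {x} = {y \<in> A. x < y}"
    using assms by force
  ultimately show ?thesis
    using sorted_list_of_set_nonempty[of A] assms by auto
qed

lemma newton_indices_from_neq_Nil: "newton_indices_from p f a \<noteq> []"
  by (subst newton_indices_from.simps) simp

lemma hd_newton_indices_from: "hd (newton_indices_from p f a) = a"
  by (subst newton_indices_from.simps) simp

lemma edges_Cons: "Ps \<noteq> [] \<Longrightarrow> edges (P # Ps) = (P, hd Ps) # edges Ps"
  by (cases Ps) (simp_all add: edges_def)

text \<open>The invariant of the recursion: \<open>t\<close> is a slope whose face ends at the
  current vertex, and the edges still to come belong to the larger break slopes. After one step the
  slope of the edge just traversed takes the place of \<open>t\<close>.\<close>

lemma edges_newton_indices_from:
  assumes "dirichlet_poly f" and "\<exists>i. f i \<noteq> 0" and "a = Max (newton_face p f t)"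
  shows "edges (map (newton_point p f) (newton_indices_from p f a)) =
    map (newton_face_edge p f) (sorted_list_of_set {s \<in> break_slopes p f. t < s})"
  using assms
proof (induction p f a arbitrary: t rule: newton_indices_from.induct)
  case (1 p f a)
  note f = "1.prems"(1,2)
  have a: "a \<in> newton_face p f t"
    using Max_newton_face_in[OF f] "1.prems"(3) by simp
  then have fa: "f a \<noteq> 0"
    by (simp add: newton_face_def)
  have face_ge: "a \<le> i" if "t < s" "i \<in> newton_face p f s" for s i
    using newton_height_less_left[OF f(1) a, of i s] that fa
    by (force simp: newton_face_def not_less[symmetric])
  show ?case
  proof (cases "newton_candidates p f a = {}")
    case True
    \<comment> \<open>Without a candidate no index of the support exceeds \<open>a\<close>, while
      faces of larger slope contain no index below \<open>a\<close>. They all shrink to the single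
      index \<open>a\<close>.\<close>
    have "{s \<in> break_slopes p f. t < s} = {}"
    proof safe
      fix s assume s: "s \<in> break_slopes p f" "t < s"
      have "Max (newton_face p f s) \<le> a"
        using newton_candidates_nonempty[OF f(1) "1.prems"(3) a] True
          Max_newton_face_in[OF f, of p s]
        by (force simp: newton_face_def not_less[symmetric])
      moreover have "a \<le> Min (newton_face p f s)"
        using face_ge s(2) Min_newton_face_in[OF f] by blast
      ultimately show "s \<in> {}"
        using s(1) by (simp add: break_slopes_def)
    qed
    then have "sorted_list_of_set {s \<in> break_slopes p f. t < s} = []"
      by (simp only: sorted_list_of_set.sorted_key_list_of_set_empty)
    moreover have "newton_indices_from p f a = [a]"
      by (subst newton_indices_from.simps) (simp add: True)
    ultimately show ?thesis
      by (simp add: edges_def)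
  next
    case False
    define b where "b = Max (newton_candidates p f a)"
    have fin: "finite (newton_candidates p f a)"
      using f(1) by (rule finite_newton_candidates)
    have "b \<in> newton_candidates p f a"
      using Max_in[OF fin False] by (simp add: b_def)
    then obtain s where s: "a < b" "a \<in> newton_face p f s" "b \<in> newton_face p f s"
      using newton_candidates_iff[OF f(1) fa] by blast
    \<comment> \<open>The face of \<open>t\<close> ends at \<open>a\<close>, so it cannot contain
      \<open>b\<close>; for a slope below \<open>t\<close> the index \<open>a\<close> would be
      strictly lower than \<open>b\<close>.\<close>
    have "t < s"
    proof (rule ccontr)
      assume "\<not> t < s"
      moreover have "s \<noteq> t"
        using s(1,3) finite_newton_face[OF f(1)] "1.prems"(3) Max_ge leD by metis
      ultimately have "newton_height p f s a < newton_height p f s b"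
        using newton_height_less_right[OF f(1) a _ s(1)] s(3) by (simp add: newton_face_def)
      then show False
        using newton_height_eq[OF s(2,3)] by simp
    qed
    \<comment> \<open>The edge found by the recursion spans the whole face: nothing lies left of
      \<open>a\<close> since the slope exceeds \<open>t\<close>, and any later member would itself
      be a candidate. Choosing the largest candidate is what absorbs collinear intermediate
      points.\<close>
    have Min: "Min (newton_face p f s) = a"
      using finite_newton_face[OF f(1)] face_ge[OF \<open>t < s\<close>] s(2) by (intro Min_eqI) auto
    have Max: "Max (newton_face p f s) = b"
    proof (rule Max_eqI)
      fix i assume i: "i \<in> newton_face p f s"
      show "i \<le> b"
      proof (cases "a < i")
        case True
        then have "i \<in> newton_candidates p f a"
          using newton_candidates_iff[OF f(1) fa] i s(2) by blast
        then show ?thesis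
          using fin by (simp add: b_def)
      qed (use s(1) in simp)
    qed (use finite_newton_face[OF f(1)] s(3) in auto)
    have break: "s \<in> break_slopes p f"
      using Min Max s(1) by (simp add: break_slopes_def)
    \<comment> \<open>A face for a slope strictly between \<open>t\<close> and \<open>s\<close> is
      confined to \<open>a\<close> from both sides, so no break slope is skipped.\<close>
    have least: "s \<le> r" if r: "r \<in> break_slopes p f" "t < r" for r
    proof (rule ccontr)
      assume "\<not> s \<le> r"
      then have "i \<le> a" if "i \<in> newton_face p f r" for i
        using newton_height_less_right[OF f(1) s(2), of i r] that fa
        by (force simp: newton_face_def not_less[symmetric])
      then have "Max (newton_face p f r) \<le> a"
        using Max_newton_face_in[OF f] by blast
      moreover have "a \<le> Min (newton_face p f r)"
        using face_ge r(2) Min_newton_face_in[OF f] by blast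
      ultimately show False
        using r(1) by (simp add: break_slopes_def)
    qed
    have "sorted_list_of_set {r \<in> break_slopes p f. t < r} =
        s # sorted_list_of_set {y \<in> {r \<in> break_slopes p f. t < r}. s < y}"
      using finite_break_slopes[OF f] break \<open>t < s\<close> least by (intro sorted_list_of_set_Cons) auto
    also have "{y \<in> {r \<in> break_slopes p f. t < r}. s < y} = {r \<in> break_slopes p f. s < r}"
      using \<open>t < s\<close> by auto
    finally have list: "sorted_list_of_set {r \<in> break_slopes p f. t < r} =
        s # sorted_list_of_set {r \<in> break_slopes p f. s < r}" .
    have "newton_indices_from p f a = a # newton_indices_from p f b"
      by (subst newton_indices_from.simps) (simp add: False f(1) b_def)
    moreover have "edges (map (newton_point p f) (newton_indices_from p f b)) =
        map (newton_face_edge p f) (sorted_list_of_set {r \<in> break_slopes p f. s < r})"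
      unfolding b_def using False f Max by (intro "1.IH") (auto simp: b_def)
    ultimately show ?thesis
      by (simp add: edges_Cons newton_indices_from_neq_Nil hd_map hd_newton_indices_from list
          newton_face_edge_def Min Max)
  qed
qed

text \<open>Supplies the initial slope of the invariant: a sufficiently small slope favours the
  smallest index alone.\<close>

lemma ex_newton_face_eq_Min_support:
  assumes "dirichlet_poly f" and "\<exists>i. f i \<noteq> 0"
  shows "\<exists>t. newton_face p f t = {Min {i. f i \<noteq> 0}}"
proof -
  define S where "S = {i. f i \<noteq> 0}"
  define m where "m = Min S"
  have S: "finite S" "S \<noteq> {}"
    using assms by (auto simp: S_def dirichlet_poly_def)
  then have m: "m \<in> S" "\<And>i. i \<in> S \<Longrightarrow> m \<le> i"
    by (simp_all add: m_def)
  then have pos: "0 < m"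
    using assms(1) by (auto simp: S_def intro: dirichlet_poly_index_pos)
  define \<sigma> where "\<sigma> i = (real (multiplicity p (f i)) - real (multiplicity p (f m))) /
      (ln (real i) - ln (real m))" for i
  \<comment> \<open>Subtracting 1 puts \<open>t\<close> strictly below all slopes from
    \<open>m\<close>. The value \<open>\<sigma> m\<close> is 0 by division by zero; it can only
    lower the minimum and keeps the set nonempty.\<close>
  define t where "t = Min (\<sigma> ` S) - 1"
  have less: "newton_height p f t m < newton_height p f t i" if "i \<in> S" "i \<noteq> m" for i
  proof -
    have "Min (\<sigma> ` S) \<le> \<sigma> i"
      using S that(1) by (intro Min_le) auto
    then have "t < \<sigma> i"
      unfolding t_def by linarith
    moreover have "0 < ln (real i) - ln (real m)"
      using m(2)[OF that(1)] that(2) pos by simp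
    ultimately show ?thesis
      by (simp add: \<sigma>_def newton_height_def field_simps)
  qed
  have "newton_face p f t = {m}"
  proof (intro set_eqI iffI)
    fix i assume "i \<in> newton_face p f t"
    then show "i \<in> {m}"
      using less[of i] m(1) by (force simp: newton_face_def S_def)
  next
    fix i assume "i \<in> {m}"
    then show "i \<in> newton_face p f t"
      using less m(1) by (force simp: newton_face_def S_def)
  qed
  then show ?thesis
    by (auto simp: m_def S_def)
qed

lemma newton_edges_eq:
  assumes "dirichlet_poly f" and "\<exists>i. f i \<noteq> 0"
  shows "newton_edges p f = map (newton_face_edge p f) (sorted_list_of_set (break_slopes p f))"
proof -
  define m where "m = Min {i. f i \<noteq> 0}"
  obtain t where t: "newton_face p f t = {m}"
    using ex_newton_face_eq_Min_support[OF assms] by (auto simp: m_def)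
  have m: "f m \<noteq> 0" "\<And>i. f i \<noteq> 0 \<Longrightarrow> m \<le> i"
    using t assms(1) by (auto simp: newton_face_def m_def dirichlet_poly_def)
  \<comment> \<open>Below \<open>t\<close> the smallest index is favoured even more, so the face
    remains \<open>{m}\<close> and there is no break.\<close>
  have "t < s" if s: "s \<in> break_slopes p f" for s
  proof (rule ccontr)
    assume "\<not> t < s"
    have "i = m" if i: "i \<in> newton_face p f s" for i
    proof (cases "s = t")
      case False
      have "f i \<noteq> 0" "newton_height p f s i \<le> newton_height p f s m"
        using i m(1) by (auto simp: newton_face_def)
      then show ?thesis
        using newton_height_less_right[OF assms(1), of m p t i s] t m(2)[of i] False
          \<open>\<not> t < s\<close> by fastforce
    qed (use i t in simp)
    then have "newton_face p f s = {m}"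
      using newton_face_nonempty[OF assms] by blast
    then show False
      using s by (simp add: break_slopes_def)
  qed
  then have "{s \<in> break_slopes p f. t < s} = break_slopes p f"
    by blast
  then show ?thesis
    using edges_newton_indices_from[OF assms, of m p t] t
    by (simp add: newton_edges_def newton_vertices_def m_def)
qed

lemma newton_slopes_eq:
  assumes "dirichlet_poly f" and "\<exists>i. f i \<noteq> 0"
  shows "newton_slopes p f = break_slopes p f"
  using edge_slope_newton_face_edge[OF assms] finite_break_slopes[OF assms]
  by (force simp: newton_slopes_def newton_edges_eq[OF assms] image_image)

text \<open>The slope determines the edge, which resolves the definite description. Without an edge
  the width is zero, in agreement with the default zero vector, so additivity of widths covers all
  cases at once.\<close>

lemma newton_vector_eq:
  assumes "dirichlet_poly f" and "\<exists>i. f i \<noteq> 0"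
  shows "newton_vector p f s = newton_width p f s *\<^sub>R (1, s)"
proof (cases "s \<in> break_slopes p f")
  case True
  have "(THE e. e \<in> set (newton_edges p f) \<and> edge_slope e = s) = newton_face_edge p f s"
    using edge_slope_newton_face_edge[OF assms] finite_break_slopes[OF assms] True
    by (intro the_equality) (auto simp: newton_edges_eq[OF assms])
  then show ?thesis
    using True by (simp add: newton_vector_def newton_slopes_eq[OF assms]
        edge_vector_newton_face_edge[OF assms])
next
  case False
  then have "newton_width p f s = 0"
    using newton_width_nonneg[OF assms, of p s] by (simp add: break_slopes_iff[OF assms])
  then show ?thesis
    using False by (simp add: newton_vector_def newton_slopes_eq[OF assms] zero_prod_def)
qed

lemma edge_vectors_newton_edges:
  assumes "dirichlet_poly f" and "\<exists>i. f i \<noteq> 0"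
  shows "map edge_vector (newton_edges p f) =
    map (\<lambda>s. newton_width p f s *\<^sub>R (1, s)) (sorted_list_of_set (break_slopes p f))"
  by (simp add: newton_edges_eq[OF assms] edge_vector_newton_face_edge[OF assms])

section \<open>Products\<close>

lemma finite_divisor_pairs: "0 < i \<Longrightarrow> finite {(j, k). j * k = (i::nat)}"
  by (rule finite_subset[of _ "{..i} \<times> {..i}"]) auto

lemma dirichlet_mult_nonzeroE:
  assumes "dirichlet_mult g h i \<noteq> 0"
  obtains j k where "j * k = i" and "g j \<noteq> 0" and "h k \<noteq> 0"
proof -
  have "(\<Sum>(j, k)\<in>{(j, k). j * k = i}. g j * h k) \<noteq> 0"
    using assms by (auto simp: dirichlet_mult_def split: if_splits)
  then obtain x where "x \<in> {(j, k). j * k = i}" "(case x of (j, k) \<Rightarrow> g j * h k) \<noteq> 0"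
    by (rule sum.not_neutral_contains_not_neutral)
  then show thesis
    using that[of "fst x" "snd x"] by (auto dest: mult_not_zero split: prod.splits)
qed

lemma dirichlet_poly_mult:
  assumes "dirichlet_poly g" and "dirichlet_poly h"
  shows "dirichlet_poly (dirichlet_mult g h)"
proof -
  have "{i. dirichlet_mult g h i \<noteq> 0} \<subseteq> (\<lambda>(j, k). j * k) ` ({j. g j \<noteq> 0} \<times> {k. h k \<noteq> 0})"
    by (auto elim!: dirichlet_mult_nonzeroE)
  moreover have "finite ((\<lambda>(j, k). j * k) ` ({j. g j \<noteq> 0} \<times> {k. h k \<noteq> 0}))"
    using assms by (simp add: dirichlet_poly_def)
  ultimately have "finite {i. dirichlet_mult g h i \<noteq> 0}"
    by (rule finite_subset)
  then show ?thesis
    by (simp add: dirichlet_poly_def dirichlet_mult_def)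
qed

text \<open>The ultrametric inequality: if all nonzero summands had valuation above
  \<open>?m\<close>, then \<open>p ^ Suc ?m\<close> would divide the whole coefficient.\<close>

lemma multiplicity_dirichlet_multE:
  fixes p :: "'a::{factorial_semiring, idom}"
  assumes p: "prime_elem p" and nz: "dirichlet_mult g h i \<noteq> 0"
  obtains j k where "j * k = i" and "g j \<noteq> 0" and "h k \<noteq> 0"
    and "multiplicity p (g j) + multiplicity p (h k) \<le> multiplicity p (dirichlet_mult g h i)"
proof -
  let ?m = "multiplicity p (dirichlet_mult g h i)"
  have "\<exists>j k. j * k = i \<and> g j \<noteq> 0 \<and> h k \<noteq> 0 \<and>
      multiplicity p (g j) + multiplicity p (h k) \<le> ?m"
  proof (rule ccontr)
    assume none: "\<not> ?thesis"
    have "p ^ Suc ?m dvd g j * h k" if jk: "j * k = i" for j k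
    proof (cases "g j = 0 \<or> h k = 0")
      case False
      then have "\<not> multiplicity p (g j) + multiplicity p (h k) \<le> ?m"
        using none jk by blast
      then have "Suc ?m \<le> multiplicity p (g j) + multiplicity p (h k)"
        by simp
      also have "\<dots> = multiplicity p (g j * h k)"
        using False p by (simp add: prime_elem_multiplicity_mult_distrib)
      finally show ?thesis
        by (rule multiplicity_dvd')
    qed auto
    moreover have "i \<noteq> 0"
      using nz by (metis dirichlet_mult_def)
    ultimately have "p ^ Suc ?m dvd dirichlet_mult g h i"
      unfolding dirichlet_mult_def by (auto intro!: dvd_sum simp del: power_Suc)
    then have "Suc ?m \<le> ?m"
      using p nz by (intro multiplicity_geI) auto
    then show False by simp
  qed
  then show thesis
    using that by blast
qed

text \<open>The equality case of the ultrametric inequality: a summand of strictly least valuation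
  cannot be cancelled by the remainder \<open>r\<close>, which is divisible by a higher power of
  \<open>p\<close>.\<close>

lemma multiplicity_dirichlet_mult_unique_min:
  fixes p :: "'a::{factorial_semiring, idom}"
  assumes p: "prime_elem p" and pos: "0 < a * b" and nz: "g a \<noteq> 0" "h b \<noteq> 0"
    and min: "\<And>j k. j * k = a * b \<Longrightarrow> (j, k) \<noteq> (a, b) \<Longrightarrow> g j \<noteq> 0 \<Longrightarrow> h k \<noteq> 0 \<Longrightarrow>
      multiplicity p (g a) + multiplicity p (h b) < multiplicity p (g j) + multiplicity p (h k)"
  shows "dirichlet_mult g h (a * b) \<noteq> 0"
    and "multiplicity p (dirichlet_mult g h (a * b)) = multiplicity p (g a) + multiplicity p (h b)"
proof -
  define n where "n = multiplicity p (g a) + multiplicity p (h b)"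
  define X where "X = {(j, k). j * k = a * b} - {(a, b)}"
  define r where "r = (\<Sum>(j, k)\<in>X. g j * h k)"
  have split: "dirichlet_mult g h (a * b) = g a * h b + r"
    using pos finite_divisor_pairs[OF pos]
    by (simp add: dirichlet_mult_def r_def X_def sum.remove[of _ "(a, b)"])
  have gh: "g a * h b \<noteq> 0" "multiplicity p (g a * h b) = n"
    using nz p by (simp_all add: n_def prime_elem_multiplicity_mult_distrib)
  have "p ^ Suc n dvd g j * h k" if "(j, k) \<in> X" for j k
  proof (cases "g j = 0 \<or> h k = 0")
    case False
    then have "Suc n \<le> multiplicity p (g j) + multiplicity p (h k)"
      using min[of j k] that by (simp add: X_def n_def)
    also have "\<dots> = multiplicity p (g j * h k)"
      using False p by (simp add: prime_elem_multiplicity_mult_distrib)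
    finally show ?thesis
      by (rule multiplicity_dvd')
  qed auto
  then have r: "p ^ Suc n dvd r"
    unfolding r_def by (intro dvd_sum) auto
  have "\<not> p ^ Suc n dvd g a * h b"
  proof
    assume "p ^ Suc n dvd g a * h b"
    then have "Suc n \<le> multiplicity p (g a * h b)"
      using p gh(1) by (intro multiplicity_geI) auto
    then show False
      using gh(2) by simp
  qed
  then have ndvd: "\<not> p ^ Suc n dvd dirichlet_mult g h (a * b)"
    using r by (simp add: split dvd_add_left_iff)
  then show "dirichlet_mult g h (a * b) \<noteq> 0"
    by auto
  have "p ^ n dvd g a * h b"
    using gh(2) by (metis multiplicity_dvd)
  moreover have "p ^ n dvd r"
    using r by (meson dvd_trans le_imp_power_dvd le_SucI order_refl)
  ultimately have "p ^ n dvd dirichlet_mult g h (a * b)"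
    by (simp add: split)
  then show "multiplicity p (dirichlet_mult g h (a * b)) =
      multiplicity p (g a) + multiplicity p (h b)"
    unfolding n_def[symmetric] using ndvd by (intro multiplicity_eqI)
qed

section \<open>Faces of a Dirichlet product\<close>

locale dirichlet_product =
  fixes p :: "'a::{factorial_semiring, idom}" and g h :: "nat \<Rightarrow> 'a"
  assumes p: "prime_elem p"
    and g: "dirichlet_poly g" "\<exists>i. g i \<noteq> 0"
    and h: "dirichlet_poly h" "\<exists>i. h i \<noteq> 0"
begin

abbreviation f :: "nat \<Rightarrow> 'a" where
  "f \<equiv> dirichlet_mult g h"

lemma newton_height_mult_ge:
  assumes "f i \<noteq> 0"
  obtains j k where "j * k = i" and "g j \<noteq> 0" and "h k \<noteq> 0"
    and "newton_height p g s j + newton_height p h s k \<le> newton_height p f s i"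
proof -
  obtain j k where jk: "j * k = i" "g j \<noteq> 0" "h k \<noteq> 0"
    and le: "multiplicity p (g j) + multiplicity p (h k) \<le> multiplicity p (f i)"
    using multiplicity_dirichlet_multE[OF p assms] .
  have "0 < j" "0 < k"
    using jk g(1) h(1) by (auto intro: dirichlet_poly_index_pos)
  then have "ln (real i) = ln (real j) + ln (real k)"
    using jk(1) by (auto simp: ln_mult)
  then have "newton_height p g s j + newton_height p h s k \<le> newton_height p f s i"
    using le by (simp add: newton_height_def algebra_simps)
  with jk show thesis by (rule that)
qed

lemma newton_height_mult_eq:
  assumes a: "a \<in> newton_face p g s" and b: "b \<in> newton_face p h s"
    and unique: "\<And>j k. j \<in> newton_face p g s \<Longrightarrow> k \<in> newton_face p h s \<Longrightarrow>
      j * k = a * b \<Longrightarrow> (j, k) = (a, b)"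
  shows "f (a * b) \<noteq> 0"
    and "newton_height p f s (a * b) = newton_height p g s a + newton_height p h s b"
proof -
  have nz: "g a \<noteq> 0" "h b \<noteq> 0"
    using a b by (auto simp: newton_face_def)
  then have pos: "0 < a" "0 < b"
    using g(1) h(1) by (auto intro: dirichlet_poly_index_pos)
  have min: "multiplicity p (g a) + multiplicity p (h b) < multiplicity p (g j) + multiplicity p (h k)"
    if jk: "j * k = a * b" "(j, k) \<noteq> (a, b)" "g j \<noteq> 0" "h k \<noteq> 0" for j k
  proof -
    have le: "newton_height p g s a \<le> newton_height p g s j"
        "newton_height p h s b \<le> newton_height p h s k"
      using a b jk by (auto simp: newton_face_def)
    have "j \<notin> newton_face p g s \<or> k \<notin> newton_face p h s"
      using unique jk(1,2) by blast
    then have "newton_height p g s a \<noteq> newton_height p g s j \<or>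
        newton_height p h s b \<noteq> newton_height p h s k"
      using a b jk(3,4) by (auto simp: newton_face_def)
    with le have "newton_height p g s a + newton_height p h s b <
        newton_height p g s j + newton_height p h s k"
      by linarith
    \<comment> \<open>Both pairs have the same product, so the logarithmic parts of the heights
      agree and the strict inequality passes to the valuations.\<close>
    moreover have "ln (real j) + ln (real k) = ln (real a) + ln (real b)"
    proof -
      have "0 < j" "0 < k"
        using jk(3,4) g(1) h(1) by (auto intro: dirichlet_poly_index_pos)
      moreover have "real j * real k = real a * real b"
        using jk(1) by (metis of_nat_mult)
      ultimately show ?thesis
        using pos by (metis ln_mult_pos of_nat_0_less_iff)
    qed
    then have "s * ln (real j) + s * ln (real k) = s * ln (real a) + s * ln (real b)"
      by (metis distrib_left)
    ultimately show ?thesis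
      unfolding newton_height_def by linarith
  qed
  have "0 < a * b"
    using pos by simp
  note * = multiplicity_dirichlet_mult_unique_min[where g = g and h = h, OF p this nz min]
  show "f (a * b) \<noteq> 0"
    by (rule *(1))
  show "newton_height p f s (a * b) = newton_height p g s a + newton_height p h s b"
    using *(2) pos by (simp add: newton_height_def ln_mult algebra_simps)
qed

text \<open>Multiplication of positive integers is strictly monotone, so raising either factor above
  its minimum raises the product.\<close>

lemma Min_newton_faces_unique:
  assumes "j \<in> newton_face p g s" and "k \<in> newton_face p h s"
    and "j * k = Min (newton_face p g s) * Min (newton_face p h s)"
  shows "(j, k) = (Min (newton_face p g s), Min (newton_face p h s))"
proof -
  let ?a = "Min (newton_face p g s)" and ?b = "Min (newton_face p h s)"
  have le: "?a \<le> j" "?b \<le> k"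
    using assms g h by (auto simp: finite_newton_face)
  have pos: "0 < ?a" "0 < ?b"
    using g h by (auto intro: Min_newton_face_pos)
  show ?thesis
  proof (rule ccontr)
    assume "(j, k) \<noteq> (?a, ?b)"
    with le consider "?a < j" | "?b < k" by fastforce
    then have "?a * ?b < j * k"
      using le pos by cases (auto intro: mult_less_le_imp_less mult_le_less_imp_less)
    then show False
      using assms(3) by simp
  qed
qed

lemma Max_newton_faces_unique:
  assumes "j \<in> newton_face p g s" and "k \<in> newton_face p h s"
    and "j * k = Max (newton_face p g s) * Max (newton_face p h s)"
  shows "(j, k) = (Max (newton_face p g s), Max (newton_face p h s))"
proof -
  let ?a = "Max (newton_face p g s)" and ?b = "Max (newton_face p h s)"
  have le: "j \<le> ?a" "k \<le> ?b"
    using assms g h by (auto simp: finite_newton_face)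
  have pos: "0 < j" "0 < k"
    using assms g h by (auto simp: newton_face_def intro: dirichlet_poly_index_pos)
  show ?thesis
  proof (rule ccontr)
    assume "(j, k) \<noteq> (?a, ?b)"
    with le consider "j < ?a" | "k < ?b" by fastforce
    then have "j * k < ?a * ?b"
      using le pos by cases (auto intro: mult_less_le_imp_less mult_le_less_imp_less)
    then show False
      using assms(3) by simp
  qed
qed

lemma newton_height_face_sum_le:
  assumes "a \<in> newton_face p g s" and "b \<in> newton_face p h s" and "f i \<noteq> 0"
  shows "newton_height p g s a + newton_height p h s b \<le> newton_height p f s i"
proof -
  obtain j k where jk: "g j \<noteq> 0" "h k \<noteq> 0"
    "newton_height p g s j + newton_height p h s k \<le> newton_height p f s i"
    using newton_height_mult_ge[OF assms(3)] .
  moreover have "newton_height p g s a \<le> newton_height p g s j"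
      "newton_height p h s b \<le> newton_height p h s k"
    using assms jk by (auto simp: newton_face_def)
  ultimately show ?thesis
    by linarith
qed

lemma mult_in_newton_face:
  assumes "a \<in> newton_face p g s" and "b \<in> newton_face p h s"
    and "\<And>j k. j \<in> newton_face p g s \<Longrightarrow> k \<in> newton_face p h s \<Longrightarrow>
      j * k = a * b \<Longrightarrow> (j, k) = (a, b)"
  shows "a * b \<in> newton_face p f s"
proof -
  have "f (a * b) \<noteq> 0"
    and "newton_height p f s (a * b) = newton_height p g s a + newton_height p h s b"
    using newton_height_mult_eq[OF assms] by blast+
  then show ?thesis
    using newton_height_face_sum_le[OF assms(1,2)] by (simp add: newton_face_def)
qed

lemma Min_mult_in_newton_face:
  "Min (newton_face p g s) * Min (newton_face p h s) \<in> newton_face p f s"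
  by (rule mult_in_newton_face[OF Min_newton_face_in[OF g] Min_newton_face_in[OF h]
        Min_newton_faces_unique])

lemma Max_mult_in_newton_face:
  "Max (newton_face p g s) * Max (newton_face p h s) \<in> newton_face p f s"
  by (rule mult_in_newton_face[OF Max_newton_face_in[OF g] Max_newton_face_in[OF h]
        Max_newton_faces_unique])

text \<open>The least height of \<open>f\<close> is the sum of the least heights of the factors, as
  the product of the smallest indices shows. A pair responsible for a minimising index of
  \<open>f\<close> must then be minimal in both components. The converse may fail through
  cancellation.\<close>

lemma newton_face_multE:
  assumes "i \<in> newton_face p f s"
  obtains j k where "j \<in> newton_face p g s" and "k \<in> newton_face p h s" and "j * k = i"
proof -
  let ?a = "Min (newton_face p g s)" and ?b = "Min (newton_face p h s)"
  have a: "?a \<in> newton_face p g s" and b: "?b \<in> newton_face p h s"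
    using g h by (auto intro: Min_newton_face_in)
  have "f i \<noteq> 0"
    using assms by (simp add: newton_face_def)
  then obtain j k where jk: "j * k = i" "g j \<noteq> 0" "h k \<noteq> 0"
    and le: "newton_height p g s j + newton_height p h s k \<le> newton_height p f s i"
    using newton_height_mult_ge[where s = s] by blast
  have "newton_height p f s i = newton_height p f s (?a * ?b)"
    using assms Min_mult_in_newton_face by (rule newton_height_eq)
  also have "\<dots> = newton_height p g s ?a + newton_height p h s ?b"
    by (rule newton_height_mult_eq[OF a b Min_newton_faces_unique])
  finally have "newton_height p f s i = newton_height p g s ?a + newton_height p h s ?b" .
  moreover have "newton_height p g s ?a \<le> newton_height p g s j"
      "newton_height p h s ?b \<le> newton_height p h s k"
    using a b jk by (auto simp: newton_face_def)
  ultimately have "newton_height p g s j = newton_height p g s ?a"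
      "newton_height p h s k = newton_height p h s ?b"
    using le by linarith+
  then have "j \<in> newton_face p g s" "k \<in> newton_face p h s"
    using a b jk by (auto simp: newton_face_def)
  then show thesis
    using jk(1) that by blast
qed

lemma dirichlet_poly_f: "dirichlet_poly f" "\<exists>i. f i \<noteq> 0"
  using dirichlet_poly_mult[OF g(1) h(1)] Min_mult_in_newton_face newton_face_subset by blast+

lemma Min_newton_face_mult:
  "Min (newton_face p f s) = Min (newton_face p g s) * Min (newton_face p h s)"
  using finite_newton_face[OF dirichlet_poly_f(1)] Min_mult_in_newton_face
    finite_newton_face[OF g(1)] finite_newton_face[OF h(1)]
  by (intro Min_eqI) (auto elim!: newton_face_multE intro!: mult_le_mono)

lemma Max_newton_face_mult:
  "Max (newton_face p f s) = Max (newton_face p g s) * Max (newton_face p h s)"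
  using finite_newton_face[OF dirichlet_poly_f(1)] Max_mult_in_newton_face
    finite_newton_face[OF g(1)] finite_newton_face[OF h(1)]
  by (intro Max_eqI) (auto elim!: newton_face_multE intro!: mult_le_mono)

lemma newton_width_mult: "newton_width p f s = newton_width p g s + newton_width p h s"
  using Min_newton_face_pos[OF g, of p s] Min_newton_face_pos[OF h, of p s]
    Max_newton_face_pos[OF g, of p s] Max_newton_face_pos[OF h, of p s]
  by (simp add: newton_width_def Min_newton_face_mult Max_newton_face_mult ln_mult)

text \<open>A sum of two nonnegative widths is positive exactly if one of them is.\<close>

lemma break_slopes_mult: "break_slopes p f = break_slopes p g \<union> break_slopes p h"
  using newton_width_nonneg[OF g, of p] newton_width_nonneg[OF h, of p]
  by (auto simp: break_slopes_iff[OF g] break_slopes_iff[OF h] break_slopes_iff[OF dirichlet_poly_f]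
      newton_width_mult add_pos_nonneg add_nonneg_pos)

end

section \<open>Polygonal lines with prescribed edge vectors\<close>

text \<open>Encodes a polygonal line by its starting point and edge vectors, so that translating and
  rearranging edges become operations on a list of vectors.\<close>

fun walk :: "real \<times> real \<Rightarrow> (real \<times> real) list \<Rightarrow> (real \<times> real) list" where
  "walk P [] = [P]"
| "walk P (v # vs) = P # walk (P + v) vs"

lemma walk_neq_Nil: "walk P vs \<noteq> []"
  by (cases vs) simp_all

lemma hd_walk: "hd (walk P vs) = P"
  by (cases vs) simp_all

lemma edge_vectors_walk: "map edge_vector (edges (walk P vs)) = vs"
  by (induction vs arbitrary: P)
    (simp_all add: edges_Cons walk_neq_Nil hd_walk edge_vector_def, simp add: edges_def)

lemma walk_edge_vectors: "Ps \<noteq> [] \<Longrightarrow> walk (hd Ps) (map edge_vector (edges Ps)) = Ps"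
proof (induction Ps)
  case (Cons P Ps)
  then show ?case
    by (cases "Ps = []") (simp add: edges_def, simp add: edges_Cons edge_vector_def)
qed simp

lemma polygonal_line_Cons:
  "Ps \<noteq> [] \<Longrightarrow> polygonal_line (P # Ps) = closed_segment P (hd Ps) \<union> polygonal_line Ps"
  by (auto simp: polygonal_line_def edges_Cons)

lemma polygonal_line_walk_Cons:
  "polygonal_line (walk P (v # vs)) = closed_segment P (P + v) \<union> polygonal_line (walk (P + v) vs)"
  by (simp add: polygonal_line_Cons walk_neq_Nil hd_walk)

lemma closed_segment_join:
  fixes P w :: "'a::euclidean_space"
  assumes "0 \<le> a" and "0 \<le> b"
  shows "closed_segment P (P + a *\<^sub>R w) \<union> closed_segment (P + a *\<^sub>R w) (P + a *\<^sub>R w + b *\<^sub>R w) =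
    closed_segment P (P + (a + b) *\<^sub>R w)"
proof -
  have "P + a *\<^sub>R w \<in> closed_segment P (P + (a + b) *\<^sub>R w)"
  proof (cases "a + b = 0")
    case False
    \<comment> \<open>The fraction of the combined segment at which the two pieces meet.\<close>
    define q where "q = a / (a + b)"
    have "q * (a + b) = a"
      using False by (simp add: q_def)
    moreover have "(1 - q) *\<^sub>R P + q *\<^sub>R (P + (a + b) *\<^sub>R w) = P + (q * (a + b)) *\<^sub>R w"
      by (simp add: algebra_simps)
    ultimately have "P + a *\<^sub>R w = (1 - q) *\<^sub>R P + q *\<^sub>R (P + (a + b) *\<^sub>R w)"
      by simp
    moreover have "0 \<le> q" "q \<le> 1"
      using assms False by (auto simp: q_def divide_le_eq_1)
    ultimately show ?thesis
      by (auto simp: closed_segment_def)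
  qed (use assms in auto)
  then show ?thesis
    using Un_closed_segment by (simp add: scaleR_add_left add.assoc)
qed

text \<open>A list of length at most one rather than a possibly zero vector: an absent edge must not
  enter the multiset of edges.\<close>

definition slope_vectors :: "(real \<Rightarrow> real) \<Rightarrow> real \<Rightarrow> (real \<times> real) list" where
  "slope_vectors u s = (if 0 < u s then [u s *\<^sub>R (1, s)] else [])"

text \<open>For a slope present in both factors the left line takes two consecutive collinear edges
  where the right one takes their sum. The covered points are the same.\<close>

lemma polygonal_line_walk_slope_vectors:
  assumes "\<And>s. s \<in> set ss \<Longrightarrow> 0 \<le> u s \<and> 0 \<le> v s \<and> 0 < u s + v s"
  shows "polygonal_line (walk P (concat (map (\<lambda>s. slope_vectors u s @ slope_vectors v s) ss))) =
    polygonal_line (walk P (map (\<lambda>s. (u s + v s) *\<^sub>R (1, s)) ss))"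
  using assms
proof (induction ss arbitrary: P)
  case (Cons s ss)
  note IH = Cons.IH[OF Cons.prems, simplified]
  have uv: "0 \<le> u s" "0 \<le> v s" "0 < u s + v s"
    using Cons.prems by auto
  consider "u s = 0" | "v s = 0" | "0 < u s" "0 < v s"
    using uv by linarith
  then show ?case
  proof cases
    case 3
    then show ?thesis
      using closed_segment_join[OF uv(1,2), of P "(1, s)"] IH
      by (simp add: slope_vectors_def polygonal_line_walk_Cons Un_assoc[symmetric]
          del: walk.simps scaleR_Pair) (simp add: algebra_simps)
  qed (use uv IH in \<open>simp_all add: slope_vectors_def polygonal_line_walk_Cons del: walk.simps\<close>)
qed simp

lemma concat_slope_vectors:
  "concat (map (slope_vectors u) ss) = map (\<lambda>s. u s *\<^sub>R (1, s)) (filter (\<lambda>s. 0 < u s) ss)"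
  by (induction ss) (simp_all add: slope_vectors_def)

lemma mset_concat_map_append:
  "mset (concat (map (\<lambda>x. A x @ B x) xs)) = mset (concat (map A xs)) + mset (concat (map B xs))"
  by (induction xs) simp_all

text \<open>Each \<open>s\<close> contributes only vectors of slope \<open>s\<close>. The order is
  not strict, as both factors may contribute the same slope.\<close>

lemma sorted_slopes_slope_vectors:
  assumes "sorted ss"
  shows "sorted (map (\<lambda>w. snd w / fst w)
    (concat (map (\<lambda>s. slope_vectors u s @ slope_vectors v s) ss)))"
  using assms by (induction ss) (auto simp: sorted_append slope_vectors_def split: if_splits)

lemma filter_sorted_list_of_set:
  fixes A :: "'a::linorder set"
  assumes "finite A"
  shows "filter P (sorted_list_of_set A) = sorted_list_of_set {x \<in> A. P x}"
proof (rule sorted_distinct_set_unique)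
  show "set (filter P (sorted_list_of_set A)) = set (sorted_list_of_set {x \<in> A. P x})"
    using assms by auto
qed (simp_all add: sorted_wrt_filter)

text \<open>The gcd of the empty set is 0, not 1.\<close>

lemma algebraically_primitive_nonzero: "algebraically_primitive f \<Longrightarrow> \<exists>i. f i \<noteq> 0"
  by (rule ccontr) (simp add: algebraically_primitive_def)

section \<open>Rearranging the edges of both factors\<close>

theorem theorem3p1:
  fixes p :: "'a :: {factorial_semiring, idom}" and f g h :: "nat \<Rightarrow> 'a"
  assumes "prime_elem p"
    and "dirichlet_poly g" and "dirichlet_poly h"
    and "\<not> dirichlet_constant g" and "\<not> dirichlet_constant h"
    and "algebraically_primitive g" and "algebraically_primitive h"
    and "f = dirichlet_mult g h"
  shows "(\<exists>Ps. mset (map edge_vector (edges Ps)) =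
              mset (map edge_vector (newton_edges p g)) + mset (map edge_vector (newton_edges p h)) \<and>
            sorted (map edge_slope (edges Ps)) \<and>
            newton_log_polygon p f = polygonal_line Ps) \<and>
         newton_slopes p f = newton_slopes p g \<union> newton_slopes p h \<and>
         (\<forall>S\<in>newton_slopes p f.
            newton_vector p f S = newton_vector p g S + newton_vector p h S)"
proof -
  interpret dirichlet_product p g h
    using assms by unfold_locales (auto intro: algebraically_primitive_nonzero)
  note f = dirichlet_poly_f[folded assms(8)]
    and break_slopes_mult = break_slopes_mult[folded assms(8)]
    and newton_width_mult = newton_width_mult[folded assms(8)]
  let ?u = "newton_width p g" and ?v = "newton_width p h"
  define ss where "ss = sorted_list_of_set (break_slopes p f)"
  \<comment> \<open>In increasing order of slopes, the edge vector of \<open>g\<close> is followed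
    by that of \<open>h\<close>, where they exist.\<close>
  define vs where "vs = concat (map (\<lambda>s. slope_vectors ?u s @ slope_vectors ?v s) ss)"
  \<comment> \<open>The edge vectors fix the line up to translation; starting at the first vertex of
    \<open>f\<close> fixes the translation.\<close>
  define P where "P = hd (newton_vertices p f)"
  define Ps where "Ps = walk P vs"
  have fin: "finite (break_slopes p f)"
    by (rule finite_break_slopes[OF f])
  have edges: "map edge_vector (edges Ps) = vs"
    by (simp add: Ps_def edge_vectors_walk)
  \<comment> \<open>Every break slope of a factor occurs among those of \<open>f\<close>, so the
    witness uses each edge of \<open>g\<close> and \<open>h\<close>, and each exactly once.\<close>
  have "{s \<in> break_slopes p f. 0 < ?u s} = break_slopes p g"
      "{s \<in> break_slopes p f. 0 < ?v s} = break_slopes p h"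
    by (auto simp: break_slopes_mult break_slopes_iff[OF g] break_slopes_iff[OF h])
  then have mset: "mset (map edge_vector (edges Ps)) =
      mset (map edge_vector (newton_edges p g)) + mset (map edge_vector (newton_edges p h))"
    by (simp add: edges vs_def mset_concat_map_append concat_slope_vectors ss_def
        filter_sorted_list_of_set[OF fin] edge_vectors_newton_edges[OF g]
        edge_vectors_newton_edges[OF h] del: mset_map)
  have "map edge_slope (edges Ps) = map (\<lambda>w. snd w / fst w) (map edge_vector (edges Ps))"
    by (simp add: edge_slope_def)
  then have sorted: "sorted (map edge_slope (edges Ps))"
    by (simp add: edges vs_def ss_def sorted_slopes_slope_vectors)
  \<comment> \<open>The polygon of \<open>f\<close> is recovered from its first vertex and its edge
    vectors; their widths are the sums of those of the factors, so it differs from \<open>Ps\<close>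
    only by the joints inside shared slopes.\<close>
  have "newton_vertices p f = walk P (map edge_vector (newton_edges p f))"
    unfolding P_def newton_edges_def
    by (rule walk_edge_vectors[symmetric])
      (simp add: newton_vertices_def newton_indices_from_neq_Nil)
  also have "\<dots> = walk P (map (\<lambda>s. (?u s + ?v s) *\<^sub>R (1, s)) ss)"
    by (simp add: edge_vectors_newton_edges[OF f] ss_def newton_width_mult)
  finally have "newton_log_polygon p f = polygonal_line Ps"
    unfolding newton_log_polygon_def Ps_def vs_def
    using fin newton_width_nonneg[OF g] newton_width_nonneg[OF h]
    by (subst polygonal_line_walk_slope_vectors)
      (auto simp: ss_def break_slopes_iff[OF f] newton_width_mult)
  with mset sorted have "\<exists>Ps. mset (map edge_vector (edges Ps)) =
      mset (map edge_vector (newton_edges p g)) + mset (map edge_vector (newton_edges p h)) \<and>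
      sorted (map edge_slope (edges Ps)) \<and> newton_log_polygon p f = polygonal_line Ps"
    by blast
  moreover have "newton_slopes p f = newton_slopes p g \<union> newton_slopes p h"
    by (simp add: newton_slopes_eq[OF f] newton_slopes_eq[OF g] newton_slopes_eq[OF h]
        break_slopes_mult)
  moreover have "newton_vector p f S = newton_vector p g S + newton_vector p h S" for S
    by (simp add: newton_vector_eq[OF f] newton_vector_eq[OF g] newton_vector_eq[OF h]
        newton_width_mult algebra_simps)
  ultimately show ?thesis
    by blast
qed

end
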